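(* Let $d\ge1$ and $N\ge3$ be integers, let $\mu=\mathcal{L}^d|_{[0,1]^d}$ be the uniform (Lebesgue) probability measure on the cube $[0,1]^d\subset\mathbb{R}^d$, and let $c:([0,1]^d)^N\to\mathbb{R}$ be the repulsive harmonic cost $$c(x_1,\dots,x_N)=-\sum_{i=1}^N\sum_{j=i+1}^N|x_j-x_i|^2 .$$ Then there exists an optimal cyclical transport map $T:[0,1]^d\to[0,1]^d$, that is, a Borel map with $T_\sharp\mu=\mu$ and $T^{(N)}=\mathrm{Id}$ $\mu$-a.e. attaining the minimum on the right-hand side of the following equality, which holds: $$\min_{\gamma\in\Pi_N(\mu)}\int c\,d\gamma=\min_{S_\sharp\mu=\mu,\ S^{(N)}=\mathrm{Id}}\int_{[0,1]^d} c\big(x,S(x),S^{(2)}(x),\dots,S^{(N-1)}(x)\big)\,d\mu(x),$$ where the right-hand minimum is over Borel maps $S:[0,1]^d\to[0,1]^d$ with $S_\sharp\mu=\mu$ and $S^{(N)}=\mathrm{Id}$ $\mu$-a.e. Moreover, $T$ can be taken not differentiable at any point of $[0,1]^d$.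
   Context: For a map $S$, $S^{(k)}$ denotes the $k$-fold composition of $S$ with itself. $\Pi_N(\mu)$ is the set of Borel probability measures on $(\mathbb{R}^d)^N$ all of whose $N$ marginals are equal to $\mu$ (here they are concentrated on $([0,1]^d)^N$). *)

theory Defs
  imports "HOL-Probability.Probability"
begin

definition unit_cube :: "(real ^ 'n) set" where
  "unit_cube = cbox 0 1"

text \<open>A Borel measure on the whole of \<open>\<real>\<^sup>d\<close>; the normalising factor in
  \<^const>\<open>uniform_measure\<close> is \<open>1\<close> here, so this is Lebesgue measure restricted to the cube.\<close>

definition cube_measure :: "(real ^ 'n) measure" where
  "cube_measure = uniform_measure lborel unit_cube"

text \<open>Points of \<open>(\<real>\<^sup>d)\<^sup>N\<close> are families indexed by \<open>{..<N}\<close>, so the points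
  \<open>x\<^sub>1, \<dots>, x\<^sub>N\<close> of the usual notation are \<open>x 0, \<dots>, x (N - 1)\<close>.
  Values outside \<open>{..<N}\<close> do not enter the cost.\<close>

definition harmonic_cost :: "nat \<Rightarrow> (nat \<Rightarrow> real ^ 'n) \<Rightarrow> real" where
  "harmonic_cost N x = - (\<Sum>i<N. \<Sum>j\<in>{i<..<N}. (norm (x j - x i))\<^sup>2)"

definition multimarginal_plans :: "nat \<Rightarrow> 'a::topological_space measure \<Rightarrow> (nat \<Rightarrow> 'a) measure set" where
  "multimarginal_plans N \<mu> =
     {\<gamma>. prob_space \<gamma> \<and> sets \<gamma> = sets (Pi\<^sub>M {..<N} (\<lambda>_. borel)) \<and>
         (\<forall>i<N. distr \<gamma> borel (\<lambda>x. x i) = \<mu>)}"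

text \<open>Borel maps \<open>S : Q \<rightarrow> Q\<close> with \<open>S\<^sub>\<sharp>\<mu> = \<mu>\<close> and \<open>S\<^sup>(\<^sup>N\<^sup>) = Id\<close> \<open>\<mu>\<close>-a.e., for a Borel measure
  \<open>\<mu>\<close> concentrated on the Borel set \<open>Q\<close>. Values of \<open>S\<close> outside \<open>Q\<close> are irrelevant.\<close>

definition cyclical_maps ::
    "nat \<Rightarrow> 'a::topological_space set \<Rightarrow> 'a measure \<Rightarrow> ('a \<Rightarrow> 'a) set" where
  "cyclical_maps N Q \<mu> =
     {S. S \<in> restrict_space borel Q \<rightarrow>\<^sub>M restrict_space borel Q \<and>
         distr (restrict_space \<mu> Q) borel S = \<mu> \<and>
         (AE x in \<mu>. (S ^^ N) x = x)}"

text \<open>Both integrands below are Borel and bounded almost everywhere (the plans are concentrated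
  on \<open>Q\<^sup>N\<close>, and \<open>S\<close> maps \<open>Q\<close> to \<open>Q\<close>), so the Bochner integrals are proper integrals.\<close>

definition plan_cost :: "nat \<Rightarrow> (nat \<Rightarrow> real ^ 'n) measure \<Rightarrow> real" where
  "plan_cost N \<gamma> = (\<integral>x. harmonic_cost N x \<partial>\<gamma>)"

definition cyclical_cost :: "nat \<Rightarrow> (real ^ 'n \<Rightarrow> real ^ 'n) \<Rightarrow> real" where
  "cyclical_cost N S =
     (LINT x:unit_cube|cube_measure. harmonic_cost N (\<lambda>i. (S ^^ i) x))"

end

theory Submission
  imports Defs
begin

text \<open>With \<open>m\<close> the centre of the cube, the cost is
  \<open>|\<Sum>\<^sub>i (x\<^sub>i - m)|\<^sup>2 - N \<Sum>\<^sub>i |x\<^sub>i - m|\<^sup>2\<close>. The integral of the second term depends only on the marginals, so a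
  plan is optimal as soon as \<open>\<Sum>\<^sub>i x\<^sub>i = N m\<close> almost surely. Let \<open>T\<close> add \<open>1\<close> modulo \<open>N\<close> to every base-\<open>N\<close>
  digit of every coordinate. Along an orbit of length \<open>N\<close> each digit takes every value
  \<open>0, \<dots>, N - 1\<close> once, so the orbit closes up and its sum is \<open>N m\<close>. For \<open>N \<ge> 3\<close>, changing one digit from
  \<open>0\<close> to \<open>1\<close> gives the difference quotient \<open>1\<close> and changing it from \<open>N - 2\<close> to \<open>N - 1\<close> gives
  \<open>- (N - 1)\<close>; both occur arbitrarily close to every point, so \<open>T\<close> is nowhere differentiable.\<close>

subsection \<open>Base-\<open>N\<close> digits and their cyclic shift\<close>

text \<open>Index 0 is the first digit after the radix point, so digit \<open>k\<close> has weight
  \<open>1 / real N ^ Suc k\<close>. Since \<open>mod\<close> is taken in the integers, negative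
  \<open>x\<close> have digits in the same range.\<close>

definition digit :: "nat \<Rightarrow> nat \<Rightarrow> real \<Rightarrow> int" where
  "digit N k x = \<lfloor>real N ^ Suc k * x\<rfloor> mod int N"

definition radix :: "nat \<Rightarrow> (nat \<Rightarrow> int) \<Rightarrow> real" where
  "radix N d = (\<Sum>k. d k / real N ^ Suc k)"

text \<open>Digits ignore the integer part, so this is a 1-periodic function of \<open>x\<close>.
  The amount \<open>j\<close> is a parameter because the iterates of the shift by 1 are compared
  with the shifts by \<open>j\<close>.\<close>

definition digit_shift :: "nat \<Rightarrow> nat \<Rightarrow> real \<Rightarrow> real" where
  "digit_shift N j x = radix N (\<lambda>k. (digit N k x + int j) mod int N)"

text \<open>A constant tail of digits is what makes an expansion ambiguous (\<open>N - 1, N - 1, \<dots>\<close>), or leads to an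
  ambiguous one after shifting every digit; without it the shift acts digit by digit.\<close>

definition tame :: "nat \<Rightarrow> real \<Rightarrow> bool" where
  "tame N x \<longleftrightarrow> (\<forall>c K. \<exists>k\<ge>K. digit N k x \<noteq> c)"

context
  fixes N :: nat
  assumes N: "2 \<le> N"
begin

section \<open>Digit series: convergence, range and splitting\<close>

lemma digit_range: "0 \<le> digit N k x" "digit N k x < int N"
  using N by (auto simp: digit_def)

lemma shifted_digit_range: "(0::int) \<le> a mod int N" "a mod int N < int N"
  using N by auto

text \<open>The expansion with all digits \<open>N - 1\<close> represents 1. It dominates every
  other digit series.\<close>

lemma sums_max_digit: "(\<lambda>k. (real N - 1) / real N ^ Suc k) sums 1"
proof -
  have "(\<lambda>k. (real N - 1) / real N * (1 / real N) ^ k) sums ((real N - 1) / real N * (1 / (1 - 1 / real N)))"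
    using N by (intro sums_mult geometric_sums) auto
  moreover have "(real N - 1) / real N * (1 / (1 - 1 / real N)) = 1"
    using N by (auto simp: field_simps)
  moreover have "(\<lambda>k. (real N - 1) / real N * (1 / real N) ^ k) = (\<lambda>k. (real N - 1) / real N ^ Suc k)"
    by (simp add: power_divide)
  ultimately show ?thesis
    by metis
qed

context
  fixes d :: "nat \<Rightarrow> int"
  assumes d: "\<And>k. 0 \<le> d k" "\<And>k. d k < int N"
begin

lemma digit_term_le: "d k / real N ^ Suc k \<le> (real N - 1) / real N ^ Suc k"
  using d[of k] N by (intro divide_right_mono) (auto simp: of_int_less_iff)

lemma digit_term_nonneg: "0 \<le> d k / real N ^ Suc k"
  using d[of k] by simp

lemma summable_radix: "summable (\<lambda>k. d k / real N ^ Suc k)"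
  by (rule summable_comparison_test'[OF sums_summable[OF sums_max_digit], of 0])
    (use digit_term_le d(1) in \<open>simp del: power_Suc\<close>)

lemma radix_nonneg: "0 \<le> radix N d"
  unfolding radix_def by (intro suminf_nonneg summable_radix digit_term_nonneg)

lemma radix_le_1: "radix N d \<le> 1"
proof -
  have "radix N d \<le> (\<Sum>k. (real N - 1) / real N ^ Suc k)"
    unfolding radix_def
    by (intro suminf_le summable_radix digit_term_le sums_summable[OF sums_max_digit])
  then show ?thesis
    by (simp only: sums_unique[OF sums_max_digit, symmetric])
qed

text \<open>Subtracting termwise from the series of maximal digits leaves nonnegative terms, and the
  one at \<open>k\<close> is positive.\<close>

lemma radix_less_1:
  assumes "d k \<noteq> int N - 1"
  shows "radix N d < 1"
proof -
  have "0 < (\<Sum>k. (real N - 1) / real N ^ Suc k - d k / real N ^ Suc k)"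
  proof (rule suminf_pos2[where i = k])
    show "summable (\<lambda>k. (real N - 1) / real N ^ Suc k - d k / real N ^ Suc k)"
      by (intro summable_diff summable_radix sums_summable[OF sums_max_digit])
    show "0 \<le> (real N - 1) / real N ^ Suc n - d n / real N ^ Suc n" for n
      using digit_term_le[of n] by linarith
    have "d k < int N - 1" using d(2)[of k] assms by linarith
    then have "real_of_int (d k) < real N - 1" by linarith
    then show "0 < (real N - 1) / real N ^ Suc k - d k / real N ^ Suc k"
      using N by (simp add: diff_divide_distrib[symmetric])
  qed
  also have "\<dots> = (\<Sum>k. (real N - 1) / real N ^ Suc k) - radix N d"
    unfolding radix_def
    by (intro suminf_diff[symmetric] summable_radix sums_summable[OF sums_max_digit])
  also have "(\<Sum>k. (real N - 1) / real N ^ Suc k) = 1"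
    by (rule sums_unique[OF sums_max_digit, symmetric])
  finally show ?thesis by simp
qed

text \<open>The tail is again a digit series, hence lies in \<open>[0, 1]\<close>; expansions that
  share \<open>n\<close> digits therefore differ by at most \<open>1 / real N ^ n\<close>.\<close>

lemma radix_split:
  "radix N d = (\<Sum>k<n. d k / real N ^ Suc k) + radix N (\<lambda>k. d (k + n)) / real N ^ n"
proof -
  have s: "summable (\<lambda>k. d (k + n) / real N ^ Suc k)"
  proof -
    have "summable (\<lambda>k. d (k + n) / real N ^ Suc (k + n))"
      using summable_radix by (subst summable_iff_shift)
    then have "summable (\<lambda>k. real N ^ n * (d (k + n) / real N ^ Suc (k + n)))"
      by (rule summable_mult)
    then show ?thesis
      using N by (simp add: power_add)
  qed
  have "radix N d = (\<Sum>k. d (k + n) / real N ^ Suc (k + n)) + (\<Sum>k<n. d k / real N ^ Suc k)"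
    unfolding radix_def by (rule suminf_split_initial_segment[OF summable_radix])
  also have "(\<lambda>k. d (k + n) / real N ^ Suc (k + n)) = (\<lambda>k. d (k + n) / real N ^ Suc k / real N ^ n)"
    by (simp add: power_add fun_eq_iff)
  also have "(\<Sum>k. d (k + n) / real N ^ Suc k / real N ^ n) = radix N (\<lambda>k. d (k + n)) / real N ^ n"
    unfolding radix_def by (rule suminf_divide[OF s])
  finally show ?thesis by simp
qed

end

section \<open>Uniqueness and existence of expansions\<close>

lemma floor_add_radix:
  assumes "\<And>k. 0 \<le> d k" "\<And>k. d k < int N" "d k \<noteq> int N - 1"
  shows "\<lfloor>of_int m + radix N d\<rfloor> = m"
  using radix_nonneg[of d] radix_less_1[of d k] assms by (simp add: floor_unique)

text \<open>Multiplication by \<open>N\<close> moves \<open>d 0\<close> into the integer part and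
  leaves the series of the remaining digits, which explains the induction with \<open>m\<close> and
  \<open>d\<close> arbitrary. Every tail contains a digit other than \<open>N - 1\<close>, so it
  stays below 1 and never carries into the floor.\<close>

lemma digit_add_radix:
  assumes "\<And>k. 0 \<le> d k" "\<And>k. d k < int N" "\<And>K. \<exists>k\<ge>K. d k \<noteq> int N - 1"
  shows "digit N n (of_int m + radix N d) = d n"
  using assms
proof (induction n arbitrary: m d)
  case (0 m d)
  \<comment> \<open>With \<open>k \<ge> 1\<close> this digit survives the removal of
    \<open>d 0\<close>, at index \<open>k - 1\<close>.\<close>
  obtain k where k: "k \<ge> 1" "d k \<noteq> int N - 1" using "0.prems"(3) by blast
  have "real N * radix N d = of_int (d 0) + radix N (\<lambda>k. d (Suc k))"
    using radix_split[of d 1, OF "0.prems"(1,2)] N by (simp add: field_simps)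
  then have "real N * (of_int m + radix N d) = of_int (int N * m + d 0) + radix N (\<lambda>k. d (Suc k))"
    by (simp add: algebra_simps)
  moreover have "\<lfloor>of_int (int N * m + d 0) + radix N (\<lambda>k. d (Suc k))\<rfloor> = int N * m + d 0"
    by (rule floor_add_radix[where k = "k - 1"]) (use "0.prems" k in auto)
  ultimately have "\<lfloor>real N * (of_int m + radix N d)\<rfloor> = int N * m + d 0"
    by (simp only:)
  then show ?case
    unfolding digit_def using "0.prems"(1,2)[of 0] by simp
next
  case (Suc n m d)
  have "real N * radix N d = of_int (d 0) + radix N (\<lambda>k. d (Suc k))"
    using radix_split[of d 1, OF Suc.prems(1,2)] N by (simp add: field_simps)
  then have eq: "real N * (of_int m + radix N d) = of_int (int N * m + d 0) + radix N (\<lambda>k. d (Suc k))"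
    by (simp add: algebra_simps)
  have "digit N (Suc n) (of_int m + radix N d) = digit N n (real N * (of_int m + radix N d))"
    unfolding digit_def by (simp add: mult_ac)
  also have "\<dots> = d (Suc n)"
    unfolding eq
  proof (rule Suc.IH)
    show "\<exists>k\<ge>K. d (Suc k) \<noteq> int N - 1" for K
      using Suc.prems(3)[of "Suc K"] by (metis Suc_le_D Suc_le_mono)
  qed (use Suc.prems in auto)
  finally show ?case .
qed

text \<open>The series telescopes: its terms are the differences of the truncations
  \<open>p n\<close> of \<open>x\<close> to \<open>n\<close> digits, which converge to
  \<open>x\<close> and start at \<open>\<lfloor>x\<rfloor>\<close>.\<close>

lemma radix_digit: "radix N (\<lambda>k. digit N k x) = frac x"
proof -
  define p where "p n = real_of_int \<lfloor>real N ^ n * x\<rfloor> / real N ^ n" for n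
  have step: "digit N k x / real N ^ Suc k = p (Suc k) - p k" for k
  proof -
    have "\<lfloor>real N ^ k * x\<rfloor> = \<lfloor>real N ^ Suc k * x\<rfloor> div int N"
      using floor_divide_real_eq_div[of "int N" "real N ^ Suc k * x"] N by (simp add: field_simps)
    then have "digit N k x = \<lfloor>real N ^ Suc k * x\<rfloor> - int N * \<lfloor>real N ^ k * x\<rfloor>"
      unfolding digit_def by (simp add: minus_mult_div_eq_mod)
    then have "real_of_int (digit N k x) = real_of_int \<lfloor>real N ^ Suc k * x\<rfloor> - real N * real_of_int \<lfloor>real N ^ k * x\<rfloor>"
      by simp
    then show ?thesis
      unfolding p_def using N by (simp add: field_simps)
  qed
  have "p \<longlonglongrightarrow> x"
  proof (rule tendsto_sandwich)
    have "(\<lambda>n. x - (1 / real N) ^ n) \<longlonglongrightarrow> x - 0"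
      using N by (intro tendsto_intros LIMSEQ_realpow_zero) auto
    then show "(\<lambda>n. x - (1 / real N) ^ n) \<longlonglongrightarrow> x" by simp
    show "\<forall>\<^sub>F n in sequentially. x - (1 / real N) ^ n \<le> p n"
    proof (rule always_eventually, rule allI)
      fix n
      have "real N ^ n * x - 1 \<le> real_of_int \<lfloor>real N ^ n * x\<rfloor>" by linarith
      then have "(real N ^ n * x - 1) / real N ^ n \<le> p n"
        unfolding p_def by (rule divide_right_mono) simp
      then show "x - (1 / real N) ^ n \<le> p n"
        using N by (simp add: diff_divide_distrib power_divide)
    qed
    show "\<forall>\<^sub>F n in sequentially. p n \<le> x"
    proof (rule always_eventually, rule allI)
      fix n
      have "real_of_int \<lfloor>real N ^ n * x\<rfloor> \<le> real N ^ n * x" by linarith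
      then show "p n \<le> x"
        unfolding p_def using N by (simp add: field_simps)
    qed
  qed simp
  from telescope_sums[OF this]
  have "(\<lambda>k. digit N k x / real N ^ Suc k) sums (x - p 0)"
    unfolding step .
  moreover have "x - p 0 = frac x"
    by (simp add: p_def frac_def)
  ultimately show ?thesis
    unfolding radix_def by (simp only: sums_iff)
qed

section \<open>The cyclic shift of digits and its orbits\<close>

lemma digit_shift_range: "0 \<le> digit_shift N j x" "digit_shift N j x \<le> 1"
  unfolding digit_shift_def by (intro radix_nonneg radix_le_1 shifted_digit_range)+

lemma digit_shift_0: "digit_shift N 0 x = frac x"
proof -
  have "(digit N k x + int 0) mod int N = digit N k x" for k
    using digit_range[of k x] by simp
  then show ?thesis
    by (simp add: digit_shift_def radix_digit)
qed

lemma digit_shift_base: "digit_shift N N x = frac x"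
  unfolding digit_shift_0[symmetric] digit_shift_def by simp

text \<open>Adding \<open>j\<close> permutes the residues, so a constant tail \<open>c\<close> after
  the shift would come from a constant tail \<open>c - j\<close> before it.\<close>

lemma tame_shifted_digit:
  assumes "tame N x"
  shows "\<exists>k\<ge>K. (digit N k x + int j) mod int N \<noteq> c"
proof -
  obtain k where k: "k \<ge> K" "digit N k x \<noteq> (c - int j) mod int N"
    using assms unfolding tame_def by blast
  have "(digit N k x + int j) mod int N \<noteq> c"
  proof
    assume "(digit N k x + int j) mod int N = c"
    then have "(c - int j) mod int N = (digit N k x + int j - int j) mod int N"
      by (metis mod_diff_left_eq)
    then show False
      using k(2) digit_range[of k x] by simp
  qed
  then show ?thesis using k by blast
qed

text \<open>The shifted digits do not end in a tail of digits \<open>N - 1\<close>, so they are the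
  digits of the number that they represent. The summand \<open>m\<close> makes the result available
  both for the shift itself and for the version that keeps the integer part.\<close>

lemma digit_of_shift:
  assumes "tame N x"
  shows "digit N k (of_int m + digit_shift N j x) = (digit N k x + int j) mod int N"
  unfolding digit_shift_def
  by (intro digit_add_radix[of "\<lambda>k. (digit N k x + int j) mod int N"]
    shifted_digit_range tame_shifted_digit[OF assms])

lemma tame_shift:
  assumes "tame N x"
  shows "tame N (of_int m + digit_shift N j x)"
  unfolding tame_def digit_of_shift[OF assms] by (intro allI tame_shifted_digit[OF assms])

lemma floor_shift:
  assumes "tame N x"
  shows "\<lfloor>of_int m + digit_shift N j x\<rfloor> = m"
proof -
  obtain k where "(digit N k x + int j) mod int N \<noteq> int N - 1"
    using tame_shifted_digit[OF assms, of 0 j "int N - 1"] by (elim exE conjE)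
  then show ?thesis
    unfolding digit_shift_def
    by (rule floor_add_radix[of "\<lambda>k. (digit N k x + int j) mod int N", OF shifted_digit_range])
qed

lemma digit_shift_shift:
  assumes "tame N x"
  shows "digit_shift N i (digit_shift N j x) = digit_shift N (i + j) x"
proof -
  have "(digit N k (digit_shift N j x) + int i) mod int N = (digit N k x + int (i + j)) mod int N" for k
  proof -
    have "digit N k (digit_shift N j x) = (digit N k x + int j) mod int N"
      using digit_of_shift[OF assms, of k 0 j] by simp
    then have "(digit N k (digit_shift N j x) + int i) mod int N = (digit N k x + int j + int i) mod int N"
      by (simp only: mod_add_left_eq)
    also have "digit N k x + int j + int i = digit N k x + int (i + j)"
      by simp
    finally show ?thesis .
  qed
  then show ?thesis
    unfolding digit_shift_def[of N i] digit_shift_def[of N "i + j"] by (simp only:)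
qed

text \<open>Shifts of a tame point compose additively. The bounds on \<open>x\<close> enter at
  \<open>j = 0\<close>, where the shift by 0 gives the fractional part.\<close>

lemma funpow_digit_shift:
  assumes "tame N x" "0 \<le> x" "x < 1"
  shows "(digit_shift N 1 ^^ j) x = digit_shift N j x"
proof (induction j)
  case 0
  then show ?case using assms by (simp add: digit_shift_0 frac_eq)
next
  case (Suc j)
  then show ?case using digit_shift_shift[OF assms(1), of 1 j] by simp
qed

text \<open>Passing from \<open>d\<close> to \<open>d + 1\<close> changes the sum by a telescoping
  expression, equal to \<open>(d + int N) mod int N - d mod int N = 0\<close>.\<close>

lemma sum_mod_shift: "0 \<le> d \<Longrightarrow> (\<Sum>j<N. (d + int j) mod int N) = (\<Sum>j<N. int j)"
proof (induction d rule: int_ge_induct)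
  case base
  then show ?case by (intro sum.cong) auto
next
  case (step d)
  have "(\<Sum>j<N. (d + 1 + int j) mod int N) - (\<Sum>j<N. (d + int j) mod int N)
      = (\<Sum>j<N. (d + int (Suc j)) mod int N - (d + int j) mod int N)"
    by (simp add: sum_subtractf add_ac)
  also have "\<dots> = (d + int N) mod int N - (d + int 0) mod int N"
    by (rule sum_lessThan_telescope)
  finally show ?case using step by simp
qed

text \<open>In each position the digits of the \<open>N\<close> shifts sum to
  \<open>N (N - 1) / 2\<close>, which is \<open>N / 2\<close> times the maximal digit; the series of
  maximal digits has sum 1.\<close>

lemma sum_digit_shift: "(\<Sum>j<N. digit_shift N j x) = real N / 2"
proof -
  have "(\<Sum>j<N. digit_shift N j x)
      = (\<Sum>k. \<Sum>j<N. ((digit N k x + int j) mod int N) / real N ^ Suc k)"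
    unfolding digit_shift_def radix_def
    by (rule suminf_sum[symmetric]) (intro summable_radix shifted_digit_range)
  also have "\<dots> = (\<Sum>k. real N / 2 * ((real N - 1) / real N ^ Suc k))"
  proof -
    have "(\<Sum>j<N. ((digit N k x + int j) mod int N) / real N ^ Suc k)
        = real N / 2 * ((real N - 1) / real N ^ Suc k)" for k
    proof -
      have "(\<Sum>j<N. real_of_int ((digit N k x + int j) mod int N)) = (\<Sum>j<N. real j)"
        using arg_cong[OF sum_mod_shift[OF digit_range(1)[of k x]], of real_of_int] by simp
      also have "\<dots> = real N * (real N - 1) / 2"
        by (induction N) (auto simp: field_simps)
      finally have "(\<Sum>j<N. real_of_int ((digit N k x + int j) mod int N)) / real N ^ Suc k
          = real N * (real N - 1) / 2 / real N ^ Suc k"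
        by (rule arg_cong)
      then show ?thesis
        unfolding sum_divide_distrib by (simp add: mult.assoc)
    qed
    then show ?thesis by simp
  qed
  also have "\<dots> = real N / 2 * (\<Sum>k. (real N - 1) / real N ^ Suc k)"
    by (rule suminf_mult[OF sums_summable[OF sums_max_digit]])
  finally show ?thesis
    by (simp only: sums_unique[OF sums_max_digit, symmetric] mult_1_right)
qed

text \<open>A constant tail \<open>c\<close> from position \<open>K\<close> on contributes
  \<open>c / (N - 1) / N ^ K\<close>, and the initial digits contribute a finite rational sum. Hence
  almost every point is tame.\<close>

lemma not_tame_imp_Rats:
  assumes "\<not> tame N x"
  shows "x \<in> \<rat>"
proof -
  obtain c K where cK: "\<And>k. k \<ge> K \<Longrightarrow> digit N k x = c"
    using assms unfolding tame_def by blast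
  have "radix N (\<lambda>_. c) = c / (real N - 1)"
  proof -
    have "(\<lambda>k. c / (real N - 1) * ((real N - 1) / real N ^ Suc k)) sums (c / (real N - 1) * 1)"
      by (intro sums_mult sums_max_digit)
    moreover have "c / (real N - 1) * ((real N - 1) / real N ^ Suc k) = c / real N ^ Suc k" for k
      using N by simp
    ultimately show ?thesis
      unfolding radix_def by (simp only: mult_1_right sums_iff)
  qed
  then have "frac x = (\<Sum>k<K. digit N k x / real N ^ Suc k) + c / (real N - 1) / real N ^ K"
    using radix_split[of "\<lambda>k. digit N k x" K, OF digit_range] cK by (simp add: radix_digit)
  then have "x = of_int \<lfloor>x\<rfloor> + (\<Sum>k<K. digit N k x / real N ^ Suc k) + c / (real N - 1) / real N ^ K"
    by (simp add: frac_def)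
  moreover have "\<dots> \<in> \<rat>"
    by (intro Rats_add Rats_sum Rats_divide Rats_diff Rats_power) auto
  ultimately show ?thesis by simp
qed

lemma digit_shift_measurable [measurable]: "digit_shift N j \<in> borel_measurable borel"
  unfolding digit_shift_def radix_def digit_def by measurable

end

subsection \<open>Preservation of Lebesgue measure\<close>

text \<open>Scaling the variable multiplies the measure of a preimage by
  \<open>inverse \<bar>c\<bar>\<close>, and the division after \<open>f\<close> undoes this.\<close>

lemma distr_lborel_rescale:
  fixes f :: "real \<Rightarrow> real"
  assumes [measurable]: "f \<in> borel_measurable borel"
    and f: "distr lborel borel f = lborel" and c: "c \<noteq> 0"
  shows "distr lborel borel (\<lambda>x. f (c * x) / c) = lborel"
proof (rule measure_eqI)
  fix A :: "real set" assume "A \<in> sets (distr lborel borel (\<lambda>x. f (c * x) / c))"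
  then have [measurable]: "A \<in> sets borel" by simp
  have scale: "emeasure lborel {x. c * x \<in> B} = inverse \<bar>c\<bar> * emeasure lborel B"
    if [measurable]: "B \<in> sets borel" for B
  proof -
    have "emeasure lborel {x. c * x \<in> B} = emeasure (distr lborel borel ((*) c)) B"
      by (subst emeasure_distr) (auto simp: vimage_def)
    also have "\<dots> = inverse \<bar>c\<bar> * emeasure lborel B"
      unfolding lborel_distr_mult[OF c] by (subst emeasure_density) (auto simp: nn_integral_cmult_indicator)
    finally show ?thesis .
  qed
  have "emeasure (distr lborel borel (\<lambda>x. f (c * x) / c)) A = emeasure lborel {x. c * x \<in> {y. f y / c \<in> A}}"
    by (subst emeasure_distr) (auto simp: vimage_def)
  also have "\<dots> = inverse \<bar>c\<bar> * emeasure lborel {y. f y / c \<in> A}"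
    by (rule scale) measurable
  also have "emeasure lborel {y. f y / c \<in> A} = emeasure (distr lborel borel f) {z. z / c \<in> A}"
    by (subst emeasure_distr) (auto simp: vimage_def)
  also have "\<dots> = emeasure lborel {z. z / c \<in> A}"
    unfolding f ..
  also have "inverse \<bar>c\<bar> * \<dots> = emeasure lborel {x. c * x \<in> {z. z / c \<in> A}}"
    by (rule scale[symmetric]) measurable
  also have "\<dots> = emeasure lborel A"
    using c by simp
  finally show "emeasure (distr lborel borel (\<lambda>x. f (c * x) / c)) A = emeasure lborel A" .
qed simp

text \<open>If \<open>g\<close> is within \<open>e / 2\<close> of \<open>f\<close>, the preimage of
  an interval under \<open>f\<close> lies between the \<open>g\<close>-preimages of the interval
  shrunk and enlarged by \<open>e / 2\<close> at each end. Their measures differ from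
  \<open>u - l\<close> by at most \<open>e\<close>.\<close>

lemma distr_lborel_uniform_limit:
  fixes f :: "real \<Rightarrow> real"
  assumes [measurable]: "f \<in> borel_measurable borel"
    and approx: "\<And>e. 0 < e \<Longrightarrow> \<exists>g\<in>borel_measurable borel. distr lborel borel g = lborel \<and> (\<forall>x. \<bar>g x - f x\<bar> < e)"
  shows "distr lborel borel f = lborel"
proof (rule lborel_eqI[symmetric])
  fix l u :: real assume "\<And>b. b \<in> Basis \<Longrightarrow> l \<bullet> b \<le> u \<bullet> b"
  then have lu: "l \<le> u" by simp
  have M: "emeasure (distr lborel borel f) {l<..<u} = emeasure lborel {x. f x \<in> {l<..<u}}"
    by (subst emeasure_distr) (auto simp: vimage_def)
  have g_emeasure: "emeasure lborel {x. g x \<in> {a<..<b}} = ennreal (b - a)"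
    if [measurable]: "g \<in> borel_measurable borel" and g: "distr lborel borel g = lborel" and "a \<le> b" for g a b
  proof -
    have "emeasure lborel {x. g x \<in> {a<..<b}} = emeasure (distr lborel borel g) {a<..<b}"
      by (subst emeasure_distr) (auto simp: vimage_def)
    then show ?thesis unfolding g using that by simp
  qed
  have "emeasure lborel {x. f x \<in> {l<..<u}} = ennreal (u - l)"
  proof (rule antisym; rule ennreal_le_epsilon)
    fix e :: real assume "0 < e"
    then obtain g where [measurable]: "g \<in> borel_measurable borel"
      and g: "distr lborel borel g = lborel" and close: "\<And>x. \<bar>g x - f x\<bar> < e / 2"
      using approx[of "e / 2"] by auto
    have "emeasure lborel {x. f x \<in> {l<..<u}} \<le> emeasure lborel {x. g x \<in> {l - e / 2<..<u + e / 2}}"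
    proof (rule emeasure_mono)
      show "{x. f x \<in> {l<..<u}} \<subseteq> {x. g x \<in> {l - e / 2<..<u + e / 2}}"
      proof safe
        fix x assume "f x \<in> {l<..<u}"
        with close[of x] show "g x \<in> {l - e / 2<..<u + e / 2}"
          unfolding greaterThanLessThan_iff by linarith
      qed
    qed measurable
    also have "\<dots> = ennreal (u + e / 2 - (l - e / 2))"
      using lu \<open>0 < e\<close> by (intro g_emeasure g) auto
    also have "\<dots> = ennreal (u - l) + ennreal e"
      using lu \<open>0 < e\<close> by (subst ennreal_plus[symmetric]) auto
    finally show "emeasure lborel {x. f x \<in> {l<..<u}} \<le> ennreal (u - l) + ennreal e" .
    show "ennreal (u - l) \<le> emeasure lborel {x. f x \<in> {l<..<u}} + ennreal e"
    proof (cases "u - l \<le> e")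
      \<comment> \<open>Here the shrunken interval would be empty and the bound is trivial.\<close>
      case True
      then show ?thesis by (intro add_increasing ennreal_leI) auto
    next
      case False
      have "ennreal (u - l) = ennreal (u - e / 2 - (l + e / 2)) + ennreal e"
        using False \<open>0 < e\<close> by (subst ennreal_plus[symmetric]) auto
      also have "ennreal (u - e / 2 - (l + e / 2)) = emeasure lborel {x. g x \<in> {l + e / 2<..<u - e / 2}}"
        using False by (intro g_emeasure[symmetric] g) auto
      also have "\<dots> \<le> emeasure lborel {x. f x \<in> {l<..<u}}"
      proof (rule emeasure_mono)
        show "{x. g x \<in> {l + e / 2<..<u - e / 2}} \<subseteq> {x. f x \<in> {l<..<u}}"
        proof safe
          fix x assume "g x \<in> {l + e / 2<..<u - e / 2}"
          with close[of x] show "f x \<in> {l<..<u}"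
            unfolding greaterThanLessThan_iff by linarith
        qed
      qed measurable
      finally show ?thesis by (simp add: add_right_mono)
    qed
  qed
  then show "emeasure (distr lborel borel f) (box l u) = ennreal (\<Prod>b\<in>Basis. (u - l) \<bullet> b)"
    using M by (simp add: box_real)
qed simp

text \<open>The indicator of a box is a product of functions of single coordinates, so its integral
  factors into one-dimensional ones; boxes determine Lebesgue measure.\<close>

lemma distr_lborel_componentwise:
  fixes F :: "'a::euclidean_space \<Rightarrow> 'a" and f :: "real \<Rightarrow> real"
  assumes [measurable]: "f \<in> borel_measurable borel"
    and f: "distr lborel borel f = lborel"
    and F: "\<And>x b. b \<in> Basis \<Longrightarrow> F x \<bullet> b = f (x \<bullet> b)"
  shows "F \<in> borel_measurable borel" "distr lborel borel F = lborel"
proof -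
  show [measurable]: "F \<in> borel_measurable borel"
  proof (rule borel_measurable_euclidean_space[THEN iffD2], rule ballI)
    fix b :: 'a assume "b \<in> Basis"
    then have "(\<lambda>x. F x \<bullet> b) = (\<lambda>x. f (x \<bullet> b))" by (simp add: F)
    then show "(\<lambda>x. F x \<bullet> b) \<in> borel_measurable borel" by simp
  qed
  show "distr lborel borel F = lborel"
  proof (rule lborel_eqI[symmetric])
    fix l u :: 'a assume lu: "\<And>b. b \<in> Basis \<Longrightarrow> l \<bullet> b \<le> u \<bullet> b"
    have "emeasure (distr lborel borel F) (box l u) = (\<integral>\<^sup>+x. indicator (box l u) (F x) \<partial>lborel)"
      by (subst emeasure_distr)
        (auto simp: nn_integral_indicator[symmetric] vimage_def simp del: nn_integral_indicator
          intro!: nn_integral_cong split: split_indicator)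
    also have "\<dots> = (\<integral>\<^sup>+x. (\<Prod>b\<in>Basis. indicator {l \<bullet> b<..<u \<bullet> b} (f (x \<bullet> b))) \<partial>lborel)"
      by (intro nn_integral_cong) (auto simp: box_def F split: split_indicator)
    also have "\<dots> = (\<Prod>b\<in>Basis. \<integral>\<^sup>+x. indicator {l \<bullet> b<..<u \<bullet> b} (f x) \<partial>lborel)"
      by (rule nn_integral_lborel_prod) auto
    also have "\<dots> = (\<Prod>b\<in>Basis. ennreal ((u - l) \<bullet> b))"
    proof (rule prod.cong)
      fix b :: 'a assume "b \<in> Basis"
      have "(\<integral>\<^sup>+x. indicator {l \<bullet> b<..<u \<bullet> b} (f x) \<partial>lborel) =
          (\<integral>\<^sup>+x. indicator {l \<bullet> b<..<u \<bullet> b} x \<partial>distr lborel borel f)"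
        by (subst nn_integral_distr) auto
      then show "(\<integral>\<^sup>+x. indicator {l \<bullet> b<..<u \<bullet> b} (f x) \<partial>lborel) = ennreal ((u - l) \<bullet> b)"
        unfolding f using lu[OF \<open>b \<in> Basis\<close>] by (simp add: inner_diff_left)
    qed simp
    also have "\<dots> = ennreal (\<Prod>b\<in>Basis. (u - l) \<bullet> b)"
      using lu by (intro prod_ennreal) (simp add: inner_diff_left)
    finally show "emeasure (distr lborel borel F) (box l u) = ennreal (\<Prod>b\<in>Basis. (u - l) \<bullet> b)" .
  qed simp
qed

lemma AE_lborel_componentwise:
  assumes "AE x in (lborel :: real measure). P x"
  shows "AE x in (lborel :: 'a::euclidean_space measure). \<forall>b\<in>Basis. P (x \<bullet> b)"
proof -
  obtain Z :: "real set" where Z: "{x. \<not> P x} \<subseteq> Z" "Z \<in> sets borel" "emeasure lborel Z = 0"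
    using AE_E[OF assms] by auto
  note [measurable] = Z(2)
  have "AE x in (lborel :: 'a measure). P (x \<bullet> c)" if c: "c \<in> Basis" for c
  proof (rule AE_I)
    show "{x \<in> space lborel. \<not> P (x \<bullet> c)} \<subseteq> {x. x \<bullet> c \<in> Z}" using Z(1) by auto
    show "{x. x \<bullet> c \<in> Z} \<in> sets (lborel :: 'a measure)" by measurable
    \<comment> \<open>The cylinder over \<open>Z\<close> in direction \<open>c\<close>, written as a
      product of functions of single coordinates.\<close>
    define h :: "'a \<Rightarrow> real \<Rightarrow> ennreal" where "h b = (if b = c then indicator Z else (\<lambda>_. 1))" for b
    have "emeasure lborel {x :: 'a. x \<bullet> c \<in> Z} = (\<integral>\<^sup>+x. indicator {x. x \<bullet> c \<in> Z} x \<partial>lborel)"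
      by simp
    also have "\<dots> = (\<integral>\<^sup>+x. (\<Prod>b\<in>Basis. h b (x \<bullet> b)) \<partial>(lborel :: 'a measure))"
      using c unfolding h_def by (intro nn_integral_cong) (auto simp: prod.If_cases prod.remove[of _ c] split: split_indicator)
    also have "\<dots> = (\<Prod>b\<in>Basis. \<integral>\<^sup>+x. h b x \<partial>lborel)"
      by (rule nn_integral_lborel_prod) (auto simp: h_def)
    \<comment> \<open>The factors for the other coordinates are infinite, but a zero factor makes
      the product zero in \<open>ennreal\<close>.\<close>
    also have "\<dots> = 0"
      using c Z(3) by (intro prod_zero) (auto simp: h_def intro!: bexI[of _ c])
    finally show "emeasure lborel {x :: 'a. x \<bullet> c \<in> Z} = 0" .
  qed
  then show ?thesis by (simp add: AE_finite_all)
qed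

text \<open>Shifting only the first \<open>n\<close> digits: each single shift is a piecewise translation, and the uniform
  limit is \<open>of_int \<lfloor>x\<rfloor> + digit_shift N 1 x\<close>. The integer part is kept so that everything preserves
  Lebesgue measure on the whole line.\<close>

definition partial_shift :: "nat \<Rightarrow> nat \<Rightarrow> real \<Rightarrow> real" where
  "partial_shift N n x = x + (\<Sum>k<n. ((digit N k x + 1) mod int N - digit N k x) / real N ^ Suc k)"

context
  fixes N :: nat
  assumes N: "2 \<le> N"
begin

text \<open>The map permutes unit cells: it moves each one to the right by 1, except those whose
  floor is \<open>N - 1\<close> modulo \<open>N\<close>, which go back by
  \<open>N - 1\<close>.\<close>

lemma distr_lborel_increment_mod:
  "distr lborel borel (\<lambda>y :: real. y + of_int ((\<lfloor>y\<rfloor> + 1) mod int N - \<lfloor>y\<rfloor> mod int N)) = lborel"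
    (is "distr lborel borel ?s = lborel")
proof (rule measure_eqI)
  have [measurable]: "?s \<in> borel_measurable borel" by measurable
  have trans: "emeasure lborel {y. y + c \<in> B} = emeasure lborel B"
    if [measurable]: "B \<in> sets borel" for B and c :: real
  proof -
    have "emeasure lborel {y. y + c \<in> B} = emeasure (distr lborel borel ((+) c)) B"
      by (subst emeasure_distr) (auto simp: vimage_def add_ac)
    then show ?thesis by (simp add: lborel_distr_plus)
  qed
  fix A assume "A \<in> sets (distr lborel borel ?s)"
  then have [measurable]: "A \<in> sets borel" by simp
  \<comment> \<open>The cells of residue 0 are the targets of the backward moves. Splitting
    \<open>A\<close> along \<open>Z\<close> makes each piece of the preimage a translate.\<close>
  define Z where "Z = {y :: real. \<lfloor>y\<rfloor> mod int N = 0}"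
  have [measurable]: "Z \<in> sets borel" unfolding Z_def by measurable
  have s: "?s y = (if y + 1 \<in> Z then y + (1 - real N) else y + 1)" for y
  proof -
    have "(\<lfloor>y\<rfloor> + 1) mod int N = (if \<lfloor>y\<rfloor> mod int N + 1 = int N then 0 else \<lfloor>y\<rfloor> mod int N + 1)"
    proof -
      have "(\<lfloor>y\<rfloor> + 1) mod int N = (\<lfloor>y\<rfloor> mod int N + 1) mod int N"
        by (simp only: mod_add_left_eq)
      moreover have "(\<lfloor>y\<rfloor> mod int N + 1) mod int N = \<lfloor>y\<rfloor> mod int N + 1" if "\<lfloor>y\<rfloor> mod int N + 1 \<noteq> int N"
        using that N pos_mod_bound[of "int N" "\<lfloor>y\<rfloor>"] pos_mod_sign[of "int N" "\<lfloor>y\<rfloor>"]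
        by (intro mod_pos_pos_trivial) linarith+
      ultimately show ?thesis by auto
    qed
    moreover have "y + 1 \<in> Z \<longleftrightarrow> (\<lfloor>y\<rfloor> + 1) mod int N = 0"
      unfolding Z_def by simp
    moreover have "\<lfloor>y\<rfloor> mod int N + 1 \<noteq> 0"
      using pos_mod_sign[of "int N" "\<lfloor>y\<rfloor>"] N by linarith
    ultimately show ?thesis
      by (auto split: if_splits)
  qed
  have Z: "y + (1 - real N) \<in> Z \<longleftrightarrow> y + 1 \<in> Z" for y
  proof -
    have "\<lfloor>y + (1 - real N)\<rfloor> = \<lfloor>y + 1\<rfloor> - int N" by linarith
    then show ?thesis unfolding Z_def by (simp only: mem_Collect_eq minus_mod_self2)
  qed
  have "emeasure (distr lborel borel ?s) A = emeasure lborel {y. ?s y \<in> A}"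
    by (subst emeasure_distr) (auto simp: vimage_def)
  also have "{y. ?s y \<in> A} = {y. y + 1 \<in> A - Z} \<union> {y. y + (1 - real N) \<in> A \<inter> Z}"
    unfolding s using Z by auto
  also have "emeasure lborel \<dots> = emeasure lborel {y. y + 1 \<in> A - Z} + emeasure lborel {y. y + (1 - real N) \<in> A \<inter> Z}"
    by (rule plus_emeasure[symmetric]) (auto simp: Z)
  also have "\<dots> = emeasure lborel (A - Z) + emeasure lborel (A \<inter> Z)"
    by (simp only: trans[of "A - Z"] trans[of "A \<inter> Z"] sets.Diff sets.Int \<open>A \<in> sets borel\<close> \<open>Z \<in> sets borel\<close>)
  also have "\<dots> = emeasure lborel A"
    by (subst plus_emeasure) (auto intro!: arg_cong[where f = "emeasure lborel"])
  finally show "emeasure (distr lborel borel ?s) A = emeasure lborel A" .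
qed simp

section \<open>Shifting finitely many digits and passing to the limit\<close>

lemma partial_shift_measurable [measurable]: "partial_shift N n \<in> borel_measurable borel"
  unfolding partial_shift_def digit_def by measurable

text \<open>After multiplication by \<open>real N ^ Suc n\<close>, the changes made to the earlier
  digits are integer multiples of \<open>N\<close>, so they vanish modulo \<open>N\<close>.\<close>

lemma digit_partial_shift: "digit N n (partial_shift N n x) = digit N n x"
proof -
  define z where "z = (\<Sum>k<n. ((digit N k x + 1) mod int N - digit N k x) * int N ^ (n - Suc k))"
  have "real N ^ Suc n * (((digit N k x + 1) mod int N - digit N k x) / real N ^ Suc k)
      = of_int (int N * (((digit N k x + 1) mod int N - digit N k x) * int N ^ (n - Suc k)))" if "k < n" for k
  proof -
    have "real N ^ n = real N ^ (n - Suc k) * real N ^ Suc k"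
      using that by (metis Suc_leI le_add_diff_inverse2 power_add)
    then show ?thesis using N by simp
  qed
  then have "real N ^ Suc n * partial_shift N n x = real N ^ Suc n * x + of_int (int N * z)"
    unfolding partial_shift_def z_def distrib_left sum_distrib_left of_int_sum by simp
  then have "\<lfloor>real N ^ Suc n * partial_shift N n x\<rfloor> = \<lfloor>real N ^ Suc n * x\<rfloor> + int N * z"
    by (simp only: floor_add_int)
  then show ?thesis
    unfolding digit_def by simp
qed

text \<open>The shift of one more digit is the cell permutation conjugated by a scaling, the form
  that \<open>distr_lborel_rescale\<close> handles.\<close>

lemma partial_shift_Suc:
  "partial_shift N (Suc n) x = (\<lambda>y. y + of_int ((\<lfloor>y\<rfloor> + 1) mod int N - \<lfloor>y\<rfloor> mod int N))
     (real N ^ Suc n * partial_shift N n x) / real N ^ Suc n"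
proof -
  have mod1: "(\<lfloor>y\<rfloor> + 1) mod int N = (\<lfloor>y\<rfloor> mod int N + 1) mod int N" for y :: real
    by (simp add: mod_add_left_eq)
  have "partial_shift N (Suc n) x = partial_shift N n x + ((digit N n x + 1) mod int N - digit N n x) / real N ^ Suc n"
    unfolding partial_shift_def by simp
  then show ?thesis
    using N digit_partial_shift[of n x] unfolding mod1 by (simp add: digit_def[symmetric] add_divide_distrib del: power_Suc)
qed

lemma distr_partial_shift: "distr lborel borel (partial_shift N n) = lborel"
proof (induction n)
  case 0
  have "partial_shift N 0 = (\<lambda>x. x)" by (simp add: partial_shift_def fun_eq_iff)
  then show ?case by (simp add: distr_id2)
next
  case (Suc n)
  let ?s = "\<lambda>y :: real. y + of_int ((\<lfloor>y\<rfloor> + 1) mod int N - \<lfloor>y\<rfloor> mod int N)"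
  let ?r = "\<lambda>x. ?s (real N ^ Suc n * x) / real N ^ Suc n"
  have "distr lborel borel (partial_shift N (Suc n)) = distr (distr lborel borel (partial_shift N n)) borel ?r"
    by (subst distr_distr) (auto simp: o_def partial_shift_Suc[abs_def] simp del: power_Suc)
  also have "\<dots> = lborel"
    unfolding Suc using N by (intro distr_lborel_rescale distr_lborel_increment_mod) auto
  finally show ?case .
qed

text \<open>The first \<open>n\<close> digits cancel; what remains is the difference of two tails in
  \<open>[0, 1]\<close>, divided by \<open>real N ^ n\<close>.\<close>

lemma partial_shift_approx: "\<bar>partial_shift N n x - (of_int \<lfloor>x\<rfloor> + digit_shift N 1 x)\<bar> \<le> (1 / real N) ^ n"
proof -
  let ?d = "\<lambda>k. digit N k x" and ?e = "\<lambda>k. (digit N k x + int 1) mod int N"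
  have d: "\<And>k. 0 \<le> ?d k" "\<And>k. ?d k < int N" and e: "\<And>k. 0 \<le> ?e k" "\<And>k. ?e k < int N"
    using digit_range[OF N] shifted_digit_range[OF N] by blast+
  have x: "x = of_int \<lfloor>x\<rfloor> + radix N ?d"
    using radix_digit[OF N, of x] by (simp add: frac_def)
  have "partial_shift N n x - (of_int \<lfloor>x\<rfloor> + digit_shift N 1 x)
      = radix N (\<lambda>k. ?d (k + n)) / real N ^ n - radix N (\<lambda>k. ?e (k + n)) / real N ^ n"
    unfolding partial_shift_def digit_shift_def
    using radix_split[OF N, of ?d n, OF d] radix_split[OF N, of ?e n, OF e] x
    by (simp add: diff_divide_distrib sum_subtractf)
  also have "\<dots> = (radix N (\<lambda>k. ?d (k + n)) - radix N (\<lambda>k. ?e (k + n))) / real N ^ n"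
    by (simp add: diff_divide_distrib)
  also have "\<bar>\<dots>\<bar> \<le> 1 / real N ^ n"
  proof -
    have "\<bar>radix N (\<lambda>k. ?d (k + n)) - radix N (\<lambda>k. ?e (k + n))\<bar> \<le> 1"
      using radix_nonneg[OF N, of "\<lambda>k. ?d (k + n)"] radix_le_1[OF N, of "\<lambda>k. ?d (k + n)"]
        radix_nonneg[OF N, of "\<lambda>k. ?e (k + n)"] radix_le_1[OF N, of "\<lambda>k. ?e (k + n)"] d e by force
    then show ?thesis by (simp add: divide_right_mono)
  qed
  finally show ?thesis by (simp add: power_divide)
qed

lemma distr_digit_shift: "distr lborel borel (\<lambda>x. of_int \<lfloor>x\<rfloor> + digit_shift N 1 x) = lborel"
proof (rule distr_lborel_uniform_limit)
  note [measurable] = digit_shift_measurable[OF N]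
  show "(\<lambda>x. of_int \<lfloor>x\<rfloor> + digit_shift N 1 x) \<in> borel_measurable borel" by measurable
  fix e :: real assume "0 < e"
  then obtain n where n: "(1 / real N) ^ n < e"
    using real_arch_pow_inv[of e "1 / real N"] N by auto
  then show "\<exists>g\<in>borel_measurable borel. distr lborel borel g = lborel \<and> (\<forall>x. \<bar>g x - (of_int \<lfloor>x\<rfloor> + digit_shift N 1 x)\<bar> < e)"
    using partial_shift_measurable distr_partial_shift partial_shift_approx[of n]
    by (intro bexI[of _ "partial_shift N n"]) (auto intro: le_less_trans)
qed

end

subsection \<open>Nowhere differentiability\<close>

context
  fixes N :: nat
  assumes N: "2 \<le> N"
begin

text \<open>The points share the first \<open>n\<close> digits of an expansion of \<open>x\<close>,
  have \<open>c\<close> as the next digit and zeros afterwards. Only digit \<open>n\<close> depends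
  on \<open>c\<close>, so \<open>r\<close> collects everything else in the image.\<close>

lemma digit_shift_on_cell:
  assumes x: "x \<in> {0..1}"
  obtains a r where "\<And>c. c < N \<Longrightarrow> a + real c / real N ^ Suc n \<in> {0..1}"
    "\<And>c. c < N \<Longrightarrow> \<bar>a + real c / real N ^ Suc n - x\<bar> \<le> 1 / real N ^ n"
    "\<And>c. c < N \<Longrightarrow> digit_shift N 1 (a + real c / real N ^ Suc n) = r + real (Suc c mod N) / real N ^ Suc n"
proof -
  \<comment> \<open>At \<open>x = 1\<close> all values of \<open>digit\<close> are 0 and give the
    expansion of 0; the expansion with digits \<open>N - 1\<close> keeps the cell next to 1 and
    inside the unit interval.\<close>
  obtain d where d: "\<And>k. 0 \<le> d k" "\<And>k. d k < int N" and x_eq: "x = radix N d"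
  proof (cases "x = 1")
    case True
    have "radix N (\<lambda>_. int N - 1) = 1"
      using sums_unique[OF sums_max_digit[OF N]] by (simp add: radix_def)
    with True that[of "\<lambda>_. int N - 1"] N show ?thesis by simp
  next
    case False
    with x have "x = radix N (\<lambda>k. digit N k x)"
      using radix_digit[OF N, of x] by (simp add: frac_eq[symmetric])
    then show ?thesis
      using that[of "\<lambda>k. digit N k x"] digit_range[OF N, of _ x] by blast
  qed
  define e where "e c k = (if k < n then d k else if k = n then int c else 0)" for c k
  have e: "0 \<le> e c k" "e c k < int N" if "c < N" for c k
    using d[of k] that N by (auto simp: e_def)
  define a where "a = (\<Sum>k<n. d k / real N ^ Suc k)"
  have u: "radix N (e c) = a + real c / real N ^ Suc n" if "c < N" for c
  proof -
    have "radix N (e c) = (\<Sum>k<Suc n. e c k / real N ^ Suc k) + radix N (\<lambda>k. e c (k + Suc n)) / real N ^ Suc n"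
      using e[OF that] by (rule radix_split[OF N])
    moreover have "radix N (\<lambda>k. e c (k + Suc n)) = 0"
      by (simp add: e_def radix_def)
    ultimately show ?thesis
      by (simp add: a_def e_def)
  qed
  have in_unit: "a + real c / real N ^ Suc n \<in> {0..1}" if "c < N" for c
    using radix_nonneg[OF N, of "e c", OF e[OF that]] radix_le_1[OF N, of "e c", OF e[OF that]]
    unfolding u[OF that] by simp
  have close: "\<bar>a + real c / real N ^ Suc n - x\<bar> \<le> 1 / real N ^ n" if "c < N" for c
  proof -
    have "radix N (e c) = (\<Sum>k<n. e c k / real N ^ Suc k) + radix N (\<lambda>k. e c (k + n)) / real N ^ n"
      using e[OF that] by (rule radix_split[OF N])
    also have "(\<Sum>k<n. e c k / real N ^ Suc k) = a"
      by (simp add: a_def e_def)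
    finally have "radix N (e c) = a + radix N (\<lambda>k. e c (k + n)) / real N ^ n" .
    moreover have "x = a + radix N (\<lambda>k. d (k + n)) / real N ^ n"
      unfolding x_eq a_def using d by (rule radix_split[OF N])
    ultimately have "a + real c / real N ^ Suc n - x = (radix N (\<lambda>k. e c (k + n)) - radix N (\<lambda>k. d (k + n))) / real N ^ n"
      unfolding u[OF that] by (simp add: diff_divide_distrib)
    moreover have "\<bar>radix N (\<lambda>k. e c (k + n)) - radix N (\<lambda>k. d (k + n))\<bar> \<le> 1"
      using radix_nonneg[OF N, of "\<lambda>k. e c (k + n)"] radix_le_1[OF N, of "\<lambda>k. e c (k + n)"]
        radix_nonneg[OF N, of "\<lambda>k. d (k + n)"] radix_le_1[OF N, of "\<lambda>k. d (k + n)"] d e[OF that] by force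
    ultimately show ?thesis
      by (simp add: divide_right_mono)
  qed
  \<comment> \<open>The tail of zeros becomes a tail of ones under the shift.\<close>
  define R where "R = radix N (\<lambda>_. (0 + int 1) mod int N)"
  define r where "r = (\<Sum>k<n. ((d k + int 1) mod int N) / real N ^ Suc k) + R / real N ^ Suc n"
  have shift: "digit_shift N 1 (a + real c / real N ^ Suc n) = r + real (Suc c mod N) / real N ^ Suc n"
    if "c < N" for c
  proof -
    let ?f = "\<lambda>k. (e c k + int 1) mod int N"
    have "digit N k (of_int 0 + radix N (e c)) = e c k" for k
    proof (rule digit_add_radix[OF N e[OF that]])
      show "\<exists>k\<ge>K. e c k \<noteq> int N - 1" for K
        using N by (intro exI[of _ "max K (Suc n)"]) (auto simp: e_def)
    qed
    then have "digit_shift N 1 (radix N (e c)) = radix N ?f"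
      by (simp add: digit_shift_def)
    also have "\<dots> = (\<Sum>k<Suc n. ?f k / real N ^ Suc k) + radix N (\<lambda>k. ?f (k + Suc n)) / real N ^ Suc n"
      by (rule radix_split[OF N, of ?f "Suc n", OF shifted_digit_range[OF N]])
    also have "(\<Sum>k<Suc n. ?f k / real N ^ Suc k)
        = (\<Sum>k<n. ((d k + int 1) mod int N) / real N ^ Suc k) + real (Suc c mod N) / real N ^ Suc n"
    proof -
      have "(\<Sum>k<n. ?f k / real N ^ Suc k) = (\<Sum>k<n. ((d k + int 1) mod int N) / real N ^ Suc k)"
        by (rule sum.cong) (simp_all add: e_def)
      moreover have "?f n = int (Suc c mod N)"
        by (simp add: e_def zmod_int add.commute)
      ultimately show ?thesis by simp
    qed
    also have "radix N (\<lambda>k. ?f (k + Suc n)) = R"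
      by (simp add: e_def R_def)
    finally show ?thesis
      unfolding u[OF that] r_def by simp
  qed
  show thesis
    using in_unit close shift that by blast
qed

text \<open>A derivative \<open>D\<close> at \<open>x\<close> would be close to the difference
  quotient of any two points of a small cell around \<open>x\<close>. The quotients 1 and
  \<open>- (N - 1)\<close> are \<open>N\<close> apart, too far for both.\<close>

lemma digit_shift_not_differentiable:
  assumes "N \<noteq> 2" and x: "x \<in> {0..1}"
  shows "\<not> digit_shift N 1 differentiable (at x within {0..1})"
proof
  let ?t = "digit_shift N 1"
  assume "?t differentiable (at x within {0..1})"
  then obtain D where "(?t has_real_derivative D) (at x within {0..1})"
    unfolding real_differentiable_def by blast
  \<comment> \<open>The tolerance \<open>1 / 8\<close> costs \<open>N * h / 8\<close> at each point
    of the cell, hence \<open>N / 4\<close> for a pair after division by \<open>h\<close>; two pairs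
    would give \<open>N \<le> N / 2\<close>.\<close>
  then obtain \<delta> where "0 < \<delta>"
    and \<delta>: "\<And>y. y \<in> {0..1} \<Longrightarrow> \<bar>y - x\<bar> < \<delta> \<Longrightarrow> \<bar>?t y - ?t x - D * (y - x)\<bar> \<le> 1 / 8 * \<bar>y - x\<bar>"
    unfolding has_field_derivative_def has_derivative_within_alt
    by (metis (no_types, lifting) real_norm_def zero_less_divide_1_iff zero_less_numeral)
  obtain n where "(1 / real N) ^ n < \<delta>"
    using real_arch_pow_inv[of \<delta> "1 / real N"] N \<open>0 < \<delta>\<close> by auto
  then have n: "1 / real N ^ n < \<delta>" by (simp add: power_divide)
  define h where "h = 1 / real N ^ Suc n"
  have h: "0 < h" "1 / real N ^ n = real N * h" using N by (auto simp: h_def)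
  have div_h: "\<And>c. real c / real N ^ Suc n = real c * h"
    by (simp add: h_def)
  obtain a r where u: "\<And>c. c < N \<Longrightarrow> a + real c * h \<in> {0..1}"
      "\<And>c. c < N \<Longrightarrow> \<bar>a + real c * h - x\<bar> \<le> 1 / real N ^ n"
    and t: "\<And>c. c < N \<Longrightarrow> ?t (a + real c * h) = r + real (Suc c mod N) * h"
    by (rule digit_shift_on_cell[OF x, of n, unfolded div_h]) blast
  have lin: "\<bar>?t (a + real c * h) - ?t x - D * (a + real c * h - x)\<bar> \<le> real N * h / 8" if "c < N" for c
  proof -
    have "1 / 8 * \<bar>a + real c * h - x\<bar> \<le> real N * h / 8"
      using u(2)[OF that] unfolding h(2) by simp
    then show ?thesis
      by (rule order_trans[OF \<delta>[OF u(1)[OF that] le_less_trans[OF u(2)[OF that] n]]])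
  qed
  have slope: "\<bar>(real (Suc c' mod N) - real (Suc c mod N)) - D * (real c' - real c)\<bar> \<le> real N / 4"
    if "c < N" "c' < N" for c c'
  proof -
    have "\<bar>(?t (a + real c' * h) - ?t x - D * (a + real c' * h - x)) - (?t (a + real c * h) - ?t x - D * (a + real c * h - x))\<bar>
        \<le> real N / 4 * h"
      using lin[OF that(1)] lin[OF that(2)] by linarith
    also have "(?t (a + real c' * h) - ?t x - D * (a + real c' * h - x)) - (?t (a + real c * h) - ?t x - D * (a + real c * h - x))
        = ((real (Suc c' mod N) - real (Suc c mod N)) - D * (real c' - real c)) * h"
      unfolding t[OF that(1)] t[OF that(2)] by (simp add: algebra_simps)
    finally show ?thesis
      using h(1) by (simp add: abs_mult)
  qed
  \<comment> \<open>With \<open>N \<noteq> 2\<close> the digit 1 is not the last one, so the step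
    from 0 to 1 involves no wrap-around; the step from \<open>N - 2\<close> to \<open>N - 1\<close>
    does.\<close>
  have "Suc (N - 1) mod N = 0" "Suc (N - 2) mod N = N - 1" "Suc 1 mod N = 2" "Suc 0 mod N = 1"
    using N \<open>N \<noteq> 2\<close> by (auto simp: Suc_diff_le numeral_2_eq_2)
  with slope[of 0 1] slope[of "N - 2" "N - 1"] N have "\<bar>1 - D\<bar> \<le> real N / 4" "\<bar>- (real N - 1) - D\<bar> \<le> real N / 4"
    by (auto simp: of_nat_diff)
  then show False using N by linarith
qed

end

subsection \<open>The harmonic cost of plans and orbits\<close>

lemma sum_pairs_norm_diff_sq:
  fixes x :: "nat \<Rightarrow> 'a::real_inner"
  shows "(\<Sum>i<n. \<Sum>j\<in>{i<..<n}. (norm (x j - x i))\<^sup>2) = real n * (\<Sum>i<n. (norm (x i))\<^sup>2) - (norm (\<Sum>i<n. x i))\<^sup>2"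
proof (induction n)
  case (Suc n)
  have "(\<Sum>i<Suc n. \<Sum>j\<in>{i<..<Suc n}. (norm (x j - x i))\<^sup>2)
      = (\<Sum>i<n. \<Sum>j\<in>{i<..<n}. (norm (x j - x i))\<^sup>2) + (\<Sum>i<n. (norm (x n - x i))\<^sup>2)"
  proof -
    have "{i<..<Suc n} = insert n {i<..<n}" if "i < n" for i using that by auto
    moreover have "{n<..<Suc n} = {}" by auto
    ultimately show ?thesis by (simp add: sum.distrib add.commute)
  qed
  also have "(\<Sum>i<n. (norm (x n - x i))\<^sup>2)
      = real n * (norm (x n))\<^sup>2 + (\<Sum>i<n. (norm (x i))\<^sup>2) - 2 * (x n \<bullet> (\<Sum>i<n. x i))"
    by (simp add: power2_norm_eq_inner inner_diff sum.distrib sum_subtractf inner_sum_right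
        sum_distrib_left inner_commute algebra_simps)
  finally have "(\<Sum>i<Suc n. \<Sum>j\<in>{i<..<Suc n}. (norm (x j - x i))\<^sup>2)
      = (\<Sum>i<n. \<Sum>j\<in>{i<..<n}. (norm (x j - x i))\<^sup>2)
        + (real n * (norm (x n))\<^sup>2 + (\<Sum>i<n. (norm (x i))\<^sup>2) - 2 * (x n \<bullet> (\<Sum>i<n. x i)))" .
  moreover have "(norm (\<Sum>i<Suc n. x i))\<^sup>2 = (norm (\<Sum>i<n. x i))\<^sup>2 + (norm (x n))\<^sup>2 + 2 * (x n \<bullet> (\<Sum>i<n. x i))"
    by (simp add: power2_norm_eq_inner inner_add inner_commute)
  ultimately show ?case
    unfolding Suc by (simp add: algebra_simps)
qed simp

text \<open>Differences are invariant under translation by \<open>m\<close>. The only term that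
  couples the variables is a square, which vanishes exactly when the points have mean
  \<open>m\<close> (for \<open>N > 0\<close>).\<close>

lemma harmonic_cost_centered:
  "harmonic_cost N x = (norm (\<Sum>i<N. x i - m))\<^sup>2 - real N * (\<Sum>i<N. (norm (x i - m))\<^sup>2)"
  using sum_pairs_norm_diff_sq[where n = N and x = "\<lambda>i. x i - m"] by (simp add: harmonic_cost_def)

section \<open>The uniform measure on the cube and its plans\<close>

lemma unit_cube_sets [measurable]: "unit_cube \<in> sets borel"
  by (simp add: unit_cube_def)

lemma mem_unit_cube: "x \<in> unit_cube \<longleftrightarrow> (\<forall>i. x $ i \<in> {0..1})"
  by (simp add: unit_cube_def mem_box_cart)

lemma sets_cube_measure [simp, measurable_cong]: "sets cube_measure = sets borel"
  by (simp add: cube_measure_def)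

lemma space_cube_measure [simp]: "space cube_measure = UNIV"
  by (simp add: cube_measure_def)

lemma emeasure_unit_cube: "emeasure lborel (unit_cube :: (real ^ 'n) set) = 1"
proof -
  have "(0 :: real ^ 'n) \<bullet> b \<le> 1 \<bullet> b \<and> (1 - 0 :: real ^ 'n) \<bullet> b = 1" if "b \<in> Basis" for b
    using that by (auto simp: Basis_vec_def inner_axis)
  then show ?thesis
    unfolding unit_cube_def by (subst emeasure_lborel_cbox) auto
qed

lemma emeasure_cube_measure:
  "A \<in> sets borel \<Longrightarrow> emeasure cube_measure A = emeasure lborel (unit_cube \<inter> A)"
  unfolding cube_measure_def by (subst emeasure_uniform_measure) (auto simp: emeasure_unit_cube divide_ennreal_def)

lemma AE_cube_measure_iff:
  "(AE x in cube_measure. P x) \<longleftrightarrow> (AE x in lborel. x \<in> unit_cube \<longrightarrow> P x)"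
  unfolding cube_measure_def by (subst AE_uniform_measure) (auto simp: emeasure_unit_cube)

lemma plan_AE_unit_cube:
  assumes \<gamma>: "\<gamma> \<in> multimarginal_plans N cube_measure" and i: "i < N"
  shows "AE x in \<gamma>. x i \<in> unit_cube"
proof -
  have [measurable_cong]: "sets \<gamma> = sets (Pi\<^sub>M {..<N} (\<lambda>_. borel))"
    and d: "distr \<gamma> borel (\<lambda>x. x i) = cube_measure"
    using \<gamma> i by (auto simp: multimarginal_plans_def)
  have [measurable]: "(\<lambda>x. x i) \<in> borel_measurable \<gamma>" by measurable (use i in simp)
  have "AE y in distr \<gamma> borel (\<lambda>x. x i). y \<in> unit_cube"
    unfolding d AE_cube_measure_iff by simp
  then show ?thesis
    by (subst (asm) AE_distr_iff) auto
qed

text \<open>The coordinates stay in the bounded cube almost surely, so both parts of the centred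
  cost are integrable. The second depends only on the marginals: one factor \<open>N\<close> comes
  from the cost and one from the \<open>N\<close> equal marginals.\<close>

lemma plan_cost_eq:
  fixes \<gamma> :: "(nat \<Rightarrow> real ^ 'n) measure"
  assumes \<gamma>: "\<gamma> \<in> multimarginal_plans N cube_measure"
  shows "plan_cost N \<gamma> = (\<integral>x. (norm (\<Sum>i<N. x i - m))\<^sup>2 \<partial>\<gamma>)
    - (real N)\<^sup>2 * (\<integral>y. (norm (y - m))\<^sup>2 \<partial>cube_measure)"
proof -
  interpret prob_space \<gamma> using \<gamma> by (simp add: multimarginal_plans_def)
  have [measurable_cong]: "sets \<gamma> = sets (Pi\<^sub>M {..<N} (\<lambda>_. borel))"
    using \<gamma> by (simp add: multimarginal_plans_def)
  have [measurable]: "(\<lambda>x. x i) \<in> borel_measurable \<gamma>" if "i < N" for i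
    by measurable (use that in simp)
  obtain B where B: "\<And>y. y \<in> unit_cube \<Longrightarrow> norm (y - m) \<le> B"
  proof -
    have "bounded ((\<lambda>y. y - m) ` unit_cube)"
      unfolding unit_cube_def by (intro bounded_translation_minus bounded_cbox)
    then show ?thesis using that unfolding bounded_iff by auto
  qed
  have inside: "AE x in \<gamma>. \<forall>i<N. norm (x i - m) \<le> B"
    using plan_AE_unit_cube[OF \<gamma>] B by (simp add: AE_all_countable AE_impI) (metis (mono_tags, lifting) eventually_mono)
  have int1: "integrable \<gamma> (\<lambda>x. (norm (x i - m))\<^sup>2)" if "i < N" for i
  proof (rule integrable_const_bound)
    show "AE x in \<gamma>. norm ((norm (x i - m))\<^sup>2) \<le> B\<^sup>2"
      using inside by eventually_elim (use that in \<open>auto intro: power_mono\<close>)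
  qed (use that in measurable)
  have int2: "integrable \<gamma> (\<lambda>x. (norm (\<Sum>i<N. x i - m))\<^sup>2)"
  proof (rule integrable_const_bound)
    show "AE x in \<gamma>. norm ((norm (\<Sum>i<N. x i - m))\<^sup>2) \<le> (real N * B)\<^sup>2"
      using inside
    proof eventually_elim
      case (elim x)
      then have "norm (\<Sum>i<N. x i - m) \<le> real N * B"
        using sum_norm_bound[of "{..<N}" "\<lambda>i. x i - m" B] by simp
      then show ?case by (auto intro: power_mono)
    qed
  qed measurable
  have marginal: "(\<integral>x. (norm (x i - m))\<^sup>2 \<partial>\<gamma>) = (\<integral>y. (norm (y - m))\<^sup>2 \<partial>cube_measure)" if "i < N" for i
  proof -
    have "(\<integral>y. (norm (y - m))\<^sup>2 \<partial>distr \<gamma> borel (\<lambda>x. x i)) = (\<integral>x. (norm (x i - m))\<^sup>2 \<partial>\<gamma>)"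
      using that by (intro integral_distr) measurable
    moreover have "distr \<gamma> borel (\<lambda>x. x i) = cube_measure"
      using \<gamma> that by (simp add: multimarginal_plans_def)
    ultimately show ?thesis by simp
  qed
  have "plan_cost N \<gamma> = (\<integral>x. (norm (\<Sum>i<N. x i - m))\<^sup>2 - real N * (\<Sum>i<N. (norm (x i - m))\<^sup>2) \<partial>\<gamma>)"
    unfolding plan_cost_def harmonic_cost_centered[of N _ m] ..
  also have "\<dots> = (\<integral>x. (norm (\<Sum>i<N. x i - m))\<^sup>2 \<partial>\<gamma>) - real N * (\<Sum>i<N. \<integral>x. (norm (x i - m))\<^sup>2 \<partial>\<gamma>)"
  proof -
    have "integrable \<gamma> (\<lambda>x. real N * (\<Sum>i<N. (norm (x i - m))\<^sup>2))"
      using int1 by (intro integrable_mult_right Bochner_Integration.integrable_sum) auto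
    from Bochner_Integration.integral_diff[OF int2 this] show ?thesis
      using int1 by (subst (asm) integral_mult_right_zero, subst (asm) Bochner_Integration.integral_sum) auto
  qed
  also have "(\<Sum>i<N. \<integral>x. (norm (x i - m))\<^sup>2 \<partial>\<gamma>) = real N * (\<integral>y. (norm (y - m))\<^sup>2 \<partial>cube_measure)"
    using marginal by simp
  finally show ?thesis by (simp add: power2_eq_square)
qed

text \<open>The push-forward of the uniform measure under the orbit map. The source is restricted
  because \<open>S\<close> is controlled only on the cube; the restricted abstraction produces
  points of the space of \<open>Pi\<^sub>M\<close>.\<close>

definition orbit_plan :: "nat \<Rightarrow> (real ^ 'n \<Rightarrow> real ^ 'n) \<Rightarrow> (nat \<Rightarrow> real ^ 'n) measure" where
  "orbit_plan N S = distr (restrict_space cube_measure unit_cube) (Pi\<^sub>M {..<N} (\<lambda>_. borel))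
     (\<lambda>x. \<lambda>i\<in>{..<N}. (S ^^ i) x)"

lemma prob_space_restrict_cube: "prob_space (restrict_space cube_measure unit_cube)"
  by (rule prob_spaceI) (simp add: emeasure_restrict_space emeasure_cube_measure emeasure_unit_cube)

lemma funpow_cyclical_map:
  assumes S: "S \<in> cyclical_maps N unit_cube cube_measure"
  shows "S ^^ i \<in> restrict_space borel unit_cube \<rightarrow>\<^sub>M restrict_space borel unit_cube"
    "distr (restrict_space cube_measure unit_cube) borel (S ^^ i) = cube_measure"
proof -
  have S1: "S \<in> restrict_space borel unit_cube \<rightarrow>\<^sub>M restrict_space borel unit_cube"
    and S2: "distr (restrict_space cube_measure unit_cube) borel S = cube_measure"
    using S by (auto simp: cyclical_maps_def)
  have sets_eq: "sets (restrict_space cube_measure unit_cube) = sets (restrict_space borel unit_cube)"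
    by (simp add: sets_restrict_space)
  have m: "S ^^ i \<in> restrict_space borel unit_cube \<rightarrow>\<^sub>M restrict_space borel unit_cube" for i
  proof (induction i)
    case (Suc i)
    show ?case using measurable_comp[OF Suc S1] by (simp only: funpow.simps)
  qed simp
  show "S ^^ i \<in> restrict_space borel unit_cube \<rightarrow>\<^sub>M restrict_space borel unit_cube" by (rule m)
  \<comment> \<open>This trades push-forwards from the restricted space for measures of subsets of
    the cube, so that preimages can be composed.\<close>
  have emeasure: "emeasure cube_measure (unit_cube \<inter> f -` A) = emeasure (distr (restrict_space cube_measure unit_cube) borel f) A"
    if "f \<in> restrict_space borel unit_cube \<rightarrow>\<^sub>M restrict_space borel unit_cube" "A \<in> sets borel" for f A
    using that
    by (subst emeasure_distr)
      (auto simp: measurable_cong_sets[OF sets_eq refl] measurable_restrict_space2_iff space_restrict_space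
        emeasure_restrict_space Int_commute intro!: arg_cong[where f = "emeasure cube_measure"])
  show "distr (restrict_space cube_measure unit_cube) borel (S ^^ i) = cube_measure"
  proof (induction i)
    case 0
    show ?case
    proof (rule measure_eqI)
      fix A assume "A \<in> sets (distr (restrict_space cube_measure unit_cube) borel (S ^^ 0))"
      then have "A \<in> sets borel" by simp
      then show "emeasure (distr (restrict_space cube_measure unit_cube) borel (S ^^ 0)) A = emeasure cube_measure A"
        using emeasure[OF m[of 0], of A] by (simp add: emeasure_cube_measure Int_assoc[symmetric])
    qed simp
  next
    case (Suc i)
    show ?case
    proof (rule measure_eqI)
      fix A assume "A \<in> sets (distr (restrict_space cube_measure unit_cube) borel (S ^^ Suc i))"
      then have A: "A \<in> sets borel" by simp
      have "S \<in> restrict_space borel unit_cube \<rightarrow>\<^sub>M borel"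
        using S1 by (simp add: measurable_restrict_space2_iff)
      from measurable_sets[OF this A] have "unit_cube \<inter> S -` A \<in> sets (restrict_space borel unit_cube)"
        by (simp add: space_restrict_space Int_commute)
      then have SA: "unit_cube \<inter> S -` A \<in> sets borel"
        by (auto simp: sets_restrict_space)
      \<comment> \<open>As \<open>S ^^ i\<close> maps the cube to itself, the preimage under
        \<open>S ^^ Suc i\<close> is the \<open>S ^^ i\<close>-preimage of the Borel set
        \<open>unit_cube \<inter> S -\<close> followed by \<open>A\<close>.\<close>
      have "emeasure (distr (restrict_space cube_measure unit_cube) borel (S ^^ Suc i)) A
          = emeasure cube_measure (unit_cube \<inter> (S ^^ i) -` (unit_cube \<inter> S -` A))"
        unfolding emeasure[OF m A, symmetric]
        using measurable_space[OF m[of i]]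
        by (intro arg_cong[where f = "emeasure cube_measure"]) (auto simp: space_restrict_space)
      also have "\<dots> = emeasure cube_measure (unit_cube \<inter> S -` A)"
        unfolding emeasure[OF m SA] Suc ..
      also have "\<dots> = emeasure cube_measure A"
        unfolding emeasure[OF S1 A] S2 ..
      finally show "emeasure (distr (restrict_space cube_measure unit_cube) borel (S ^^ Suc i)) A = emeasure cube_measure A" .
    qed simp
  qed
qed

lemma orbit_measurable:
  assumes S: "S \<in> cyclical_maps N unit_cube cube_measure"
  shows "(\<lambda>x. \<lambda>i\<in>{..<N}. (S ^^ i) x) \<in> restrict_space cube_measure unit_cube \<rightarrow>\<^sub>M Pi\<^sub>M {..<N} (\<lambda>_. borel)"
proof (rule measurable_restrict)
  fix i
  have "S ^^ i \<in> restrict_space borel unit_cube \<rightarrow>\<^sub>M borel"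
    using funpow_cyclical_map(1)[OF S, of i] by (simp add: measurable_restrict_space2_iff)
  then show "(\<lambda>x. (S ^^ i) x) \<in> restrict_space cube_measure unit_cube \<rightarrow>\<^sub>M borel"
    by (simp add: sets_restrict_space cong: measurable_cong_sets)
qed

lemma orbit_plan_in_plans:
  assumes S: "S \<in> cyclical_maps N unit_cube cube_measure"
  shows "orbit_plan N S \<in> multimarginal_plans N cube_measure"
  unfolding multimarginal_plans_def
proof (intro CollectI conjI allI impI)
  note orbit_measurable[OF S, measurable]
  show "prob_space (orbit_plan N S)"
    unfolding orbit_plan_def by (intro prob_space.prob_space_distr[OF prob_space_restrict_cube]) measurable
  show "sets (orbit_plan N S) = sets (Pi\<^sub>M {..<N} (\<lambda>_. borel))"
    by (simp add: orbit_plan_def)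
  fix i assume i: "i < N"
  then have "distr (orbit_plan N S) borel (\<lambda>x. x i) = distr (restrict_space cube_measure unit_cube) borel (S ^^ i)"
    unfolding orbit_plan_def by (subst distr_distr) (auto simp: o_def)
  then show "distr (orbit_plan N S) borel (\<lambda>x. x i) = cube_measure"
    using funpow_cyclical_map(2)[OF S] by simp
qed

lemma harmonic_cost_cong: "(\<And>i. i < N \<Longrightarrow> x i = y i) \<Longrightarrow> harmonic_cost N x = harmonic_cost N y"
  by (simp add: harmonic_cost_def)

text \<open>A change of variables. It embeds the cyclical problem into the problem over plans with
  the same cost.\<close>

lemma plan_cost_orbit_plan:
  assumes S: "S \<in> cyclical_maps N unit_cube cube_measure"
  shows "plan_cost N (orbit_plan N S) = cyclical_cost N S"
proof -
  have "plan_cost N (orbit_plan N S) = (\<integral>x. harmonic_cost N (\<lambda>i\<in>{..<N}. (S ^^ i) x) \<partial>restrict_space cube_measure unit_cube)"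
    unfolding plan_cost_def orbit_plan_def
  proof (rule integral_distr[OF orbit_measurable[OF S]])
    show "harmonic_cost N \<in> borel_measurable (Pi\<^sub>M {..<N} (\<lambda>_. borel))"
      unfolding harmonic_cost_def[abs_def] by measurable
  qed
  also have "\<dots> = (\<integral>x. harmonic_cost N (\<lambda>i. (S ^^ i) x) \<partial>restrict_space cube_measure unit_cube)"
    by (intro Bochner_Integration.integral_cong harmonic_cost_cong) auto
  also have "\<dots> = cyclical_cost N S"
    unfolding cyclical_cost_def set_lebesgue_integral_def
    by (rule integral_restrict_space) simp
  finally show ?thesis .
qed

lemma orbit_plan_AE:
  assumes S: "S \<in> cyclical_maps N unit_cube cube_measure"
    and P: "{x \<in> space (Pi\<^sub>M {..<N} (\<lambda>_. borel)). P x} \<in> sets (Pi\<^sub>M {..<N} (\<lambda>_. borel))"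
    and ae: "AE x in cube_measure. x \<in> unit_cube \<longrightarrow> P (\<lambda>i\<in>{..<N}. (S ^^ i) x)"
  shows "AE x in orbit_plan N S. P x"
  unfolding orbit_plan_def
  using ae by (subst AE_distr_iff[OF orbit_measurable[OF S] P]) (simp add: AE_restrict_space_iff)

subsection \<open>The digit shift on the cube\<close>

lemma vec_borel_measurable:
  fixes F :: "'a \<Rightarrow> real ^ 'n"
  assumes "\<And>i. (\<lambda>x. F x $ i) \<in> borel_measurable M"
  shows "F \<in> borel_measurable M"
  by (rule borel_measurable_euclidean_space[THEN iffD2])
    (use assms in \<open>auto simp: Basis_vec_def inner_axis\<close>)

definition cube_shift :: "nat \<Rightarrow> real ^ 'n \<Rightarrow> real ^ 'n" where
  "cube_shift N x = (\<chi> i. digit_shift N 1 (x $ i))"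

context
  fixes N :: nat
  assumes N: "2 \<le> N"
begin

lemma tame_not_Ints: "tame N x \<Longrightarrow> x \<notin> \<int>"
proof
  assume "tame N x" "x \<in> \<int>"
  then obtain m where m: "x = of_int m" by (auto elim: Ints_cases)
  have "digit N k x = 0" for k
  proof -
    have "real N ^ Suc k * x = of_int (int N * (int N ^ k * m))" unfolding m by simp
    then show ?thesis unfolding digit_def by (simp only: floor_of_int mod_mult_self1_is_0)
  qed
  with \<open>tame N x\<close> show False unfolding tame_def by blast
qed

text \<open>A tame point is never 1, so the closed interval can be replaced by a half-open cell.
  Membership in the cube then depends only on integer parts.\<close>

lemma tame_unit_interval_iff: "tame N x \<Longrightarrow> x \<in> {0..1} \<longleftrightarrow> \<lfloor>x\<rfloor> = 0"
  using tame_not_Ints[of x] by (auto simp: floor_eq_iff less_le)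

lemma AE_tame: "AE x in lborel :: (real ^ 'n) measure. \<forall>i. tame N (x $ i)"
proof -
  have "AE x in (lborel :: real measure). x \<notin> \<rat>"
    by (intro AE_not_in countable_imp_null_set_lborel countable_rat)
  then have "AE x in (lborel :: real measure). tame N x"
    by eventually_elim (use not_tame_imp_Rats[OF N] in blast)
  from AE_lborel_componentwise[OF this, where 'a = "real ^ 'n"] show ?thesis
    by eventually_elim (auto simp: Basis_vec_def inner_axis)
qed

lemma cube_shift_measurable [measurable]: "cube_shift N \<in> borel_measurable borel"
proof (rule vec_borel_measurable)
  note [measurable] = digit_shift_measurable[OF N]
  show "(\<lambda>x :: real ^ 'n. cube_shift N x $ i) \<in> borel_measurable borel" for i
    unfolding cube_shift_def by simp
qed

lemma cube_shift_in_cube: "cube_shift N x \<in> unit_cube"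
  using digit_shift_range[OF N] by (simp add: mem_unit_cube cube_shift_def)

lemma distr_cube_shift:
  "distr (restrict_space cube_measure unit_cube) borel (cube_shift N) = (cube_measure :: (real ^ 'n) measure)"
proof (rule measure_eqI)
  \<comment> \<open>\<open>F\<close> preserves Lebesgue measure on the whole space. On tame points
    it also preserves integer parts, hence the cube, and inside the cube it agrees with
    \<open>cube_shift\<close>.\<close>
  define F :: "real ^ 'n \<Rightarrow> real ^ 'n" where "F x = (\<chi> i. of_int \<lfloor>x $ i\<rfloor> + digit_shift N 1 (x $ i))" for x
  let ?f = "\<lambda>s. of_int \<lfloor>s\<rfloor> + digit_shift N 1 s"
  note [measurable] = digit_shift_measurable[OF N]
  have comp: "F x \<bullet> b = ?f (x \<bullet> b)" if "b \<in> Basis" for x b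
    using that by (auto simp: Basis_vec_def inner_axis F_def)
  have f: "?f \<in> borel_measurable borel" by measurable
  have [measurable]: "F \<in> borel_measurable borel"
    and F: "distr lborel borel F = lborel"
    using distr_lborel_componentwise[OF f distr_digit_shift[OF N] comp] by blast+
  fix A assume "A \<in> sets (distr (restrict_space cube_measure unit_cube) borel (cube_shift N :: real ^ 'n \<Rightarrow> real ^ 'n))"
  then have [measurable]: "A \<in> sets borel" by simp
  have [measurable]: "cube_shift N \<in> restrict_space cube_measure unit_cube \<rightarrow>\<^sub>M borel"
    by (rule measurable_restrict_space1) simp
  have "emeasure (distr (restrict_space cube_measure unit_cube) borel (cube_shift N)) A
      = emeasure lborel {x \<in> unit_cube. cube_shift N x \<in> A}"
    by (subst emeasure_distr)
      (auto simp: emeasure_restrict_space emeasure_cube_measure space_restrict_space Int_def vimage_def conj_commute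
        intro!: arg_cong[where f = "emeasure lborel"])
  also have "\<dots> = emeasure lborel {x. F x \<in> unit_cube \<inter> A}"
  proof (rule emeasure_eq_AE)
    show "AE x in lborel. x \<in> {x \<in> unit_cube. cube_shift N x \<in> A} \<longleftrightarrow> x \<in> {x. F x \<in> unit_cube \<inter> A}"
      using AE_tame
    proof eventually_elim
      case (elim x)
      have cube: "x \<in> unit_cube \<longleftrightarrow> (\<forall>i. \<lfloor>x $ i\<rfloor> = 0)"
        unfolding mem_unit_cube using elim tame_unit_interval_iff by blast
      also have "\<dots> \<longleftrightarrow> F x \<in> unit_cube"
      proof -
        have "F x $ i \<in> {0..1} \<longleftrightarrow> \<lfloor>x $ i\<rfloor> = 0" for i
          using tame_unit_interval_iff[OF tame_shift[OF N spec[OF elim, of i], of "\<lfloor>x $ i\<rfloor>" 1]]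
            floor_shift[OF N spec[OF elim, of i], of "\<lfloor>x $ i\<rfloor>" 1]
          unfolding F_def vec_lambda_beta by (simp only:)
        then show ?thesis unfolding mem_unit_cube by blast
      qed
      finally have "x \<in> unit_cube \<longleftrightarrow> F x \<in> unit_cube" .
      moreover have "F x = cube_shift N x" if "x \<in> unit_cube"
        using that cube by (simp add: F_def cube_shift_def)
      ultimately show ?case by auto
    qed
  qed measurable
  also have "\<dots> = emeasure (distr lborel borel F) (unit_cube \<inter> A)"
    by (subst emeasure_distr) (auto simp: vimage_def)
  also have "\<dots> = emeasure cube_measure A"
    unfolding F by (simp add: emeasure_cube_measure)
  finally show "emeasure (distr (restrict_space cube_measure unit_cube) borel (cube_shift N)) A = emeasure cube_measure A" .
qed simp

lemma AE_funpow_cube_shift: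
  "AE x in (cube_measure :: (real ^ 'n) measure). (\<forall>i. 0 \<le> x $ i \<and> x $ i < 1) \<and>
     (\<forall>j. (cube_shift N ^^ j) x = (\<chi> i. digit_shift N j (x $ i)))"
  unfolding AE_cube_measure_iff using AE_tame
proof eventually_elim
  case (elim x)
  show ?case
  proof
    assume "x \<in> unit_cube"
    then have "\<lfloor>x $ i\<rfloor> = 0" for i
      using elim tame_unit_interval_iff unfolding mem_unit_cube by blast
    then have range: "0 \<le> x $ i \<and> x $ i < 1" for i
      by (simp add: floor_eq_iff)
    have "(cube_shift N ^^ j) x = (\<chi> i. (digit_shift N 1 ^^ j) (x $ i))" for j
      by (induction j) (simp_all add: cube_shift_def)
    then show "(\<forall>i. 0 \<le> x $ i \<and> x $ i < 1) \<and>
     (\<forall>j. (cube_shift N ^^ j) x = (\<chi> i. digit_shift N j (x $ i)))"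
      using range funpow_digit_shift[OF N] elim by simp
  qed
qed

lemma cube_shift_cyclical: "(cube_shift N :: real ^ 'n \<Rightarrow> real ^ 'n) \<in> cyclical_maps N unit_cube cube_measure"
  unfolding cyclical_maps_def
proof (intro CollectI conjI)
  show "cube_shift N \<in> restrict_space borel unit_cube \<rightarrow>\<^sub>M restrict_space borel unit_cube"
    by (intro measurable_restrict_space2 measurable_restrict_space1) (auto simp: cube_shift_in_cube)
  show "distr (restrict_space cube_measure unit_cube) borel (cube_shift N) = cube_measure"
    by (rule distr_cube_shift)
  show "AE x in cube_measure. (cube_shift N ^^ N) x = x"
    using AE_funpow_cube_shift
    by eventually_elim (simp add: digit_shift_base[OF N] frac_eq vec_eq_iff)
qed

text \<open>Each coordinate of the orbit sums to \<open>N / 2\<close>, so the orbit has the centre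
  of the cube as its mean.\<close>

lemma orbit_sum_cube_shift:
  "AE x in orbit_plan N (cube_shift N :: real ^ 'n \<Rightarrow> real ^ 'n). (\<Sum>i<N. x i - (\<chi> k. 1 / 2)) = 0"
proof (rule orbit_plan_AE[OF cube_shift_cyclical])
  show "{x \<in> space (Pi\<^sub>M {..<N} (\<lambda>_. borel)). (\<Sum>i<N. x i - (\<chi> k. 1 / 2 :: real ^ 'n)) = 0}
      \<in> sets (Pi\<^sub>M {..<N} (\<lambda>_. borel))"
    by measurable
  show "AE x in cube_measure. x \<in> unit_cube \<longrightarrow>
      (\<Sum>i<N. (\<lambda>i\<in>{..<N}. (cube_shift N ^^ i) x) i - (\<chi> k. 1 / 2)) = (0 :: real ^ 'n)"
    using AE_funpow_cube_shift
  proof eventually_elim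
    case (elim x)
    have "(\<Sum>i<N. (cube_shift N ^^ i) x - (\<chi> k. 1 / 2)) $ k = (\<Sum>i<N. digit_shift N i (x $ k) - 1 / 2)" for k
      using elim by (simp only: sum_component vector_minus_component vec_lambda_beta)
    then have "(\<Sum>i<N. (cube_shift N ^^ i) x - (\<chi> k. 1 / 2)) = 0"
      by (simp only: vec_eq_iff) (simp add: sum_subtractf sum_digit_shift[OF N])
    then show ?case by simp
  qed
qed

lemma cube_shift_not_differentiable:
  fixes x :: "real ^ 'n"
  assumes "N \<noteq> 2" and x: "x \<in> unit_cube"
  shows "\<not> cube_shift N differentiable (at x within unit_cube)"
proof
  fix k :: 'n
  assume diff: "cube_shift N differentiable (at x within unit_cube)"
  \<comment> \<open>The segment through \<open>x\<close> in direction \<open>k\<close>. Along it,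
    coordinate \<open>k\<close> of \<open>cube_shift\<close> is the one-dimensional shift, which
    reduces the claim to the interval.\<close>
  define g where "g s = x + (s - x $ k) *\<^sub>R axis k 1" for s
  have g_cube: "g ` {0..1} \<subseteq> unit_cube"
    using x by (auto simp: g_def mem_unit_cube axis_def)
  have g_x: "g (x $ k) = x" by (simp add: g_def)
  have "g differentiable (at (x $ k) within {0..1})"
    unfolding g_def by (intro derivative_intros)
  moreover have "cube_shift N differentiable (at (g (x $ k)) within g ` {0..1})"
    unfolding g_x using diff g_cube by (rule differentiable_within_subset)
  ultimately have "(cube_shift N \<circ> g) differentiable (at (x $ k) within {0..1})"
    by (rule differentiable_chain_within)
  then have "((\<lambda>y. y $ k) \<circ> (cube_shift N \<circ> g)) differentiable (at (x $ k) within {0..1})"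
    by (rule differentiable_chain_within)
      (auto intro: bounded_linear_imp_differentiable bounded_linear_vec_nth)
  also have "(\<lambda>y. y $ k) \<circ> (cube_shift N \<circ> g) = digit_shift N 1"
    by (auto simp: fun_eq_iff cube_shift_def g_def)
  finally show False
    using digit_shift_not_differentiable[OF N assms(1), of "x $ k"] x by (simp add: mem_unit_cube)
qed

end

section \<open>Optimality of the digit shift\<close>

theorem corollary4p8:
  fixes N :: nat
  assumes "N \<ge> 3"
  shows "\<exists>(\<gamma> :: (nat \<Rightarrow> real ^ 'n) measure) (T :: real ^ 'n \<Rightarrow> real ^ 'n).
           is_arg_min (plan_cost N) (\<lambda>\<gamma>'. \<gamma>' \<in> multimarginal_plans N cube_measure) \<gamma> \<and>
           is_arg_min (cyclical_cost N) (\<lambda>S. S \<in> cyclical_maps N unit_cube cube_measure) T \<and>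
           plan_cost N \<gamma> = cyclical_cost N T \<and>
           (\<forall>x\<in>unit_cube. \<not> T differentiable (at x within unit_cube))"
proof (intro exI conjI)
  have N: "2 \<le> N" and "N \<noteq> 2" using assms by auto
  let ?T = "cube_shift N :: real ^ 'n \<Rightarrow> real ^ 'n"
  let ?\<gamma> = "orbit_plan N ?T"
  define m :: "real ^ 'n" where "m = (\<chi> k. 1 / 2)"
  note T = cube_shift_cyclical[OF N, where 'n = 'n]
  have optimal: "plan_cost N ?\<gamma> \<le> plan_cost N \<gamma>" if \<gamma>: "\<gamma> \<in> multimarginal_plans N cube_measure"
    for \<gamma> :: "(nat \<Rightarrow> real ^ 'n) measure"
  proof -
    \<comment> \<open>Only the squared sum distinguishes the costs of two plans. It integrates to 0
      for the orbit plan and is nonnegative for every other plan.\<close>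
    have "(\<integral>x. (norm (\<Sum>i<N. x i - m))\<^sup>2 \<partial>?\<gamma>) = 0"
      using orbit_sum_cube_shift[OF N, where 'n = 'n] unfolding m_def
      by (intro integral_eq_zero_AE) (auto elim!: eventually_mono)
    also have "\<dots> \<le> (\<integral>x. (norm (\<Sum>i<N. x i - m))\<^sup>2 \<partial>\<gamma>)"
      by simp
    finally show ?thesis
      unfolding plan_cost_eq[OF \<gamma>, of m] plan_cost_eq[OF orbit_plan_in_plans[OF T], of m] by simp
  qed
  show "is_arg_min (plan_cost N) (\<lambda>\<gamma>'. \<gamma>' \<in> multimarginal_plans N cube_measure) ?\<gamma>"
    unfolding is_arg_min_def using orbit_plan_in_plans[OF T] optimal by (auto simp: not_less)
  \<comment> \<open>Every competing map induces a plan of equal cost, so optimality among plans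
    carries over to maps.\<close>
  show "is_arg_min (cyclical_cost N) (\<lambda>S. S \<in> cyclical_maps N unit_cube cube_measure) ?T"
    unfolding is_arg_min_def
    using T optimal[OF orbit_plan_in_plans] by (auto simp: not_less plan_cost_orbit_plan)
  show "plan_cost N ?\<gamma> = cyclical_cost N ?T"
    by (rule plan_cost_orbit_plan[OF T])
  show "\<forall>x\<in>unit_cube. \<not> ?T differentiable (at x within unit_cube)"
    using cube_shift_not_differentiable[OF N \<open>N \<noteq> 2\<close>] by blast
qed

end
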